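(* Let $\mathsf{JL}$ be any justification logic from the list in the context and $\mathsf{CS}$ a constant specification for $\mathsf{JL}$. All the rules of $\mathsf{G3JL}_{\mathsf{CS}}$ are height-preserving $\mathsf{CS}$-invertible.
   Context: Justification logics. Terms are built from justification variables and constants by binary $\cdot,+$ and (depending on the logic) unary $!$, $?$, $\bar{?}$. Formulas are built from propositional variables and $\bot$ by $\neg,\wedge,\vee,\to$ and $t:A$. $\mathsf J$ has axiom schemes: propositional tautologies; $s:A\to(s+t):A$, $s:A\to(t+s):A$; $s:(A\to B)\to(t:A\to(s\cdot t):B)$. A justification logic $\mathsf{JL}$ is $\mathsf J$ extended by at most one of (jT) $t:A\to A$, (jD) $t:\bot\to\bot$, and by any subset of (j4) $t:A\to\,!t:t:A$, (jB) $\neg A\to\bar{?}t:\neg t:A$, (j5) $\neg t:A\to\,?t:\neg t:A$; its language contains $!$ (resp. $\bar{?}$, $?$) exactly when (j4) (resp. (jB), (j5)) is an axiom. A constant specification $\mathsf{CS}$ for $\mathsf{JL}$: if (j4) is not an axiom, a set of formulas $c_n:\dots:c_1:A$ ($n\ge1$, $c_j$ constants, $A$ an axiom instance), closed under passing from $c_n:c_{n-1}:\dots:c_1:A$ to $c_{n-1}:\dots:c_1:A$; if (j4) is an axiom, a set of formulas $c:A$ ($c$ a constant, $A$ an axiom instance). Calculus $\mathsf{G3JL}_{\mathsf{CS}}$. Fix a countably infinite set of labels $w,v,u,\dots$. The labeled language has labeled formulas $w\Vvdash A$, relational atoms $wRv$ and evidence atoms $wE(t,A)$ ($A$ a formula,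 $t$ a term). Sequents $\Gamma\Rightarrow\Delta$ consist of finite multisets of these. Initial sequents: $w\Vvdash P,\Gamma\Rightarrow\Delta,w\Vvdash P$ ($P$ a propositional variable); $w\Vvdash\bot,\Gamma\Rightarrow\Delta$; $wRv,\Gamma\Rightarrow\Delta,wRv$; $wE(t,A),\Gamma\Rightarrow\Delta,wE(t,A)$. Rules (premises / conclusion): (L$\neg$) $\Gamma\Rightarrow\Delta,w\Vvdash A$ / $w\Vvdash\neg A,\Gamma\Rightarrow\Delta$; (R$\neg$) $w\Vvdash A,\Gamma\Rightarrow\Delta$ / $\Gamma\Rightarrow\Delta,w\Vvdash\neg A$; (L$\wedge$) $w\Vvdash A,w\Vvdash B,\Gamma\Rightarrow\Delta$ / $w\Vvdash A\wedge B,\Gamma\Rightarrow\Delta$; (R$\wedge$) $\Gamma\Rightarrow\Delta,w\Vvdash A$ and $\Gamma\Rightarrow\Delta,w\Vvdash B$ / $\Gamma\Rightarrow\Delta,w\Vvdash A\wedge B$; (L$\vee$) $w\Vvdash A,\Gamma\Rightarrow\Delta$ and $w\Vvdash B,\Gamma\Rightarrow\Delta$ / $w\Vvdash A\vee B,\Gamma\Rightarrow\Delta$; (R$\vee$) $\Gamma\Rightarrow\Delta,w\Vvdash A,w\Vvdash B$ / $\Gamma\Rightarrow\Delta,w\Vvdash A\vee B$; (L$\to$) $\Gamma\Rightarrow\Delta,w\Vvdash A$ and $w\Vvdash B,\Gamma\Rightarrow\Delta$ / $w\Vvdash A\to B,\Gamma\Rightarrow\Delta$; (R$\to$) $w\Vvdash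 A,\Gamma\Rightarrow\Delta,w\Vvdash B$ / $\Gamma\Rightarrow\Delta,w\Vvdash A\to B$; (L:) $v\Vvdash A,w\Vvdash t:A,wRv,\Gamma\Rightarrow\Delta$ / $w\Vvdash t:A,wRv,\Gamma\Rightarrow\Delta$; (R:) $wRv,wE(t,A),\Gamma\Rightarrow\Delta,v\Vvdash A$ / $wE(t,A),\Gamma\Rightarrow\Delta,w\Vvdash t:A$, where the eigenlabel $v$ does not occur in the conclusion; (E) $wE(t,A),w\Vvdash t:A,\Gamma\Rightarrow\Delta$ / $w\Vvdash t:A,\Gamma\Rightarrow\Delta$; (El+) $wE(s+t,A),wE(t,A),\Gamma\Rightarrow\Delta$ / $wE(t,A),\Gamma\Rightarrow\Delta$; (Er+) $wE(t+s,A),wE(t,A),\Gamma\Rightarrow\Delta$ / $wE(t,A),\Gamma\Rightarrow\Delta$; (E$\cdot$) $wE(s\cdot t,B),wE(s,A\to B),wE(t,A),\Gamma\Rightarrow\Delta$ / $wE(s,A\to B),wE(t,A),\Gamma\Rightarrow\Delta$; (IAN)/(AN) $wE(c,F),\Gamma\Rightarrow\Delta$ / $\Gamma\Rightarrow\Delta$, for $c:F\in\mathsf{CS}$ ($c$ a constant). If (jT) is an axiom: (Ref) $wRw,\Gamma\Rightarrow\Delta$ / $\Gamma\Rightarrow\Delta$. If (jD) is an axiom: (Ser) $wRv,\Gamma\Rightarrow\Delta$ / $\Gamma\Rightarrow\Delta$, where the eigenlabel $v$ does not occur in the conclusion. If (j4) is an axiom: (E!) $wE(!t,t:A),wE(t,A),\Gamma\Rightarrow\Delta$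 / $wE(t,A),\Gamma\Rightarrow\Delta$; (Mon) $vE(t,A),wE(t,A),wRv,\Gamma\Rightarrow\Delta$ / $wE(t,A),wRv,\Gamma\Rightarrow\Delta$; (Trans) $wRu,wRv,vRu,\Gamma\Rightarrow\Delta$ / $wRv,vRu,\Gamma\Rightarrow\Delta$. If (jB) is an axiom: (E$\bar{?}$) $w\Vvdash A,\Gamma\Rightarrow\Delta$ and $wE(\bar{?}t,\neg t:A),\Gamma\Rightarrow\Delta$ / $\Gamma\Rightarrow\Delta$; (Sym) $vRw,wRv,\Gamma\Rightarrow\Delta$ / $wRv,\Gamma\Rightarrow\Delta$. If (j5) is an axiom: (SE) $w\Vvdash t:A,wE(t,A),\Gamma\Rightarrow\Delta$ / $wE(t,A),\Gamma\Rightarrow\Delta$; (E?) $wE(t,A),\Gamma\Rightarrow\Delta$ and $wE(?t,\neg t:A),\Gamma\Rightarrow\Delta$ / $\Gamma\Rightarrow\Delta$. The height of a derivation is the maximum number of successive rule applications in it. "Derivable with height $n$" means having a derivation of height at most $n$. A rule is height-preserving $\mathsf{CS}$-invertible if whenever an instance of its conclusion is derivable in $\mathsf{G3JL}_{\mathsf{CS}}$ with height $n$, then so is each corresponding instance of its premise(s). *)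

theory Defs
  imports "HOL-Library.Multiset"
begin

section \<open>Justification logics\<close>

text \<open>
  The types \<^typ>\<open>'x\<close>, \<^typ>\<open>'c\<close> and \<^typ>\<open>'p\<close> supply the justification variables, the
  constants and the propositional variables.  The datatypes below contain all the term
  operators; the language of a particular logic is carved out by \<open>lang_tm\<close> and \<open>lang_fm\<close>.
\<close>

datatype ('x, 'c) tm =
    JVar 'x
  | JConst 'c
  | App "('x, 'c) tm" "('x, 'c) tm"
  | Plus "('x, 'c) tm" "('x, 'c) tm"
  | Bang "('x, 'c) tm"
  | Query "('x, 'c) tm"
  | QueryBar "('x, 'c) tm"

datatype ('x, 'c, 'p) fm =
    PVar 'p
  | Bot
  | Neg "('x, 'c, 'p) fm"
  | And "('x, 'c, 'p) fm" "('x, 'c, 'p) fm"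
  | Or "('x, 'c, 'p) fm" "('x, 'c, 'p) fm"
  | Imp "('x, 'c, 'p) fm" "('x, 'c, 'p) fm"
  | Just "('x, 'c) tm" "('x, 'c, 'p) fm"

datatype ax = JT | JD | J4 | JB | J5

text \<open>A logic is given by the set of axioms it adds to the basic logic J.\<close>

definition justification_logic :: "ax set \<Rightarrow> bool" where
  "justification_logic L \<longleftrightarrow> \<not> (JT \<in> L \<and> JD \<in> L)"

primrec lang_tm :: "ax set \<Rightarrow> ('x, 'c) tm \<Rightarrow> bool" where
  "lang_tm L (JVar x) \<longleftrightarrow> True"
| "lang_tm L (JConst c) \<longleftrightarrow> True"
| "lang_tm L (App s t) \<longleftrightarrow> lang_tm L s \<and> lang_tm L t"
| "lang_tm L (Plus s t) \<longleftrightarrow> lang_tm L s \<and> lang_tm L t"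
| "lang_tm L (Bang t) \<longleftrightarrow> J4 \<in> L \<and> lang_tm L t"
| "lang_tm L (Query t) \<longleftrightarrow> J5 \<in> L \<and> lang_tm L t"
| "lang_tm L (QueryBar t) \<longleftrightarrow> JB \<in> L \<and> lang_tm L t"

primrec lang_fm :: "ax set \<Rightarrow> ('x, 'c, 'p) fm \<Rightarrow> bool" where
  "lang_fm L (PVar p) \<longleftrightarrow> True"
| "lang_fm L Bot \<longleftrightarrow> True"
| "lang_fm L (Neg A) \<longleftrightarrow> lang_fm L A"
| "lang_fm L (And A B) \<longleftrightarrow> lang_fm L A \<and> lang_fm L B"
| "lang_fm L (Or A B) \<longleftrightarrow> lang_fm L A \<and> lang_fm L B"
| "lang_fm L (Imp A B) \<longleftrightarrow> lang_fm L A \<and> lang_fm L B"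
| "lang_fm L (Just t A) \<longleftrightarrow> lang_tm L t \<and> lang_fm L A"

text \<open>
  Boolean evaluation in which justified formulas \<^term>\<open>Just t A\<close> count as atoms, so that a
  tautology is any substitution instance of a classical one.
\<close>

primrec bool_eval ::
  "('p \<Rightarrow> bool) \<Rightarrow> (('x, 'c) tm \<Rightarrow> ('x, 'c, 'p) fm \<Rightarrow> bool) \<Rightarrow> ('x, 'c, 'p) fm \<Rightarrow> bool"
where
  "bool_eval V J (PVar p) \<longleftrightarrow> V p"
| "bool_eval V J Bot \<longleftrightarrow> False"
| "bool_eval V J (Neg A) \<longleftrightarrow> \<not> bool_eval V J A"
| "bool_eval V J (And A B) \<longleftrightarrow> bool_eval V J A \<and> bool_eval V J B"
| "bool_eval V J (Or A B) \<longleftrightarrow> bool_eval V J A \<or> bool_eval V J B"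
| "bool_eval V J (Imp A B) \<longleftrightarrow> (bool_eval V J A \<longrightarrow> bool_eval V J B)"
| "bool_eval V J (Just t A) \<longleftrightarrow> J t A"

definition tautology :: "('x, 'c, 'p) fm \<Rightarrow> bool" where
  "tautology A \<longleftrightarrow> (\<forall>V J. bool_eval V J A)"

inductive axiom_scheme :: "ax set \<Rightarrow> ('x, 'c, 'p) fm \<Rightarrow> bool" for L where
  Taut: "tautology A \<Longrightarrow> axiom_scheme L A"
| SumL: "axiom_scheme L (Imp (Just s A) (Just (Plus s t) A))"
| SumR: "axiom_scheme L (Imp (Just s A) (Just (Plus t s) A))"
| Appl: "axiom_scheme L (Imp (Just s (Imp A B)) (Imp (Just t A) (Just (App s t) B)))"
| AxT: "JT \<in> L \<Longrightarrow> axiom_scheme L (Imp (Just t A) A)"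
| AxD: "JD \<in> L \<Longrightarrow> axiom_scheme L (Imp (Just t Bot) Bot)"
| Ax4: "J4 \<in> L \<Longrightarrow> axiom_scheme L (Imp (Just t A) (Just (Bang t) (Just t A)))"
| AxB: "JB \<in> L \<Longrightarrow> axiom_scheme L (Imp (Neg A) (Just (QueryBar t) (Neg (Just t A))))"
| Ax5: "J5 \<in> L \<Longrightarrow>
    axiom_scheme L (Imp (Neg (Just t A)) (Just (Query t) (Neg (Just t A))))"

definition axiom_instance :: "ax set \<Rightarrow> ('x, 'c, 'p) fm \<Rightarrow> bool" where
  "axiom_instance L A \<longleftrightarrow> lang_fm L A \<and> axiom_scheme L A"

text \<open>\<open>const_chain [c\<^sub>n, \<dots>, c\<^sub>1] A\<close> is \<open>c\<^sub>n : \<dots> : c\<^sub>1 : A\<close>.\<close>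

primrec const_chain :: "'c list \<Rightarrow> ('x, 'c, 'p) fm \<Rightarrow> ('x, 'c, 'p) fm" where
  "const_chain [] A = A"
| "const_chain (c # cs) A = Just (JConst c) (const_chain cs A)"

text \<open>
  Without (j4), downward closure stops at \<open>c\<^sub>1 : A\<close>: the axiom instance \<open>A\<close> itself is not a
  member of the specification.
\<close>

definition constant_specification :: "ax set \<Rightarrow> ('x, 'c, 'p) fm set \<Rightarrow> bool" where
  "constant_specification L CS \<longleftrightarrow>
    (if J4 \<in> L
     then \<forall>F \<in> CS. \<exists>c A. axiom_instance L A \<and> F = Just (JConst c) A
     else (\<forall>F \<in> CS. \<exists>cs A. cs \<noteq> [] \<and> axiom_instance L A \<and> F = const_chain cs A) \<and>
          (\<forall>c cs A. cs \<noteq> [] \<longrightarrow> axiom_instance L A \<longrightarrow>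
             const_chain (c # cs) A \<in> CS \<longrightarrow> const_chain cs A \<in> CS))"

section \<open>The labeled sequent calculus\<close>

type_synonym label = nat

datatype ('x, 'c, 'p) lfm =
    Forces label "('x, 'c, 'p) fm"
  | Rel label label
  | Evid label "('x, 'c) tm" "('x, 'c, 'p) fm"

datatype ('x, 'c, 'p) sequent =
  Sequent "('x, 'c, 'p) lfm multiset" "('x, 'c, 'p) lfm multiset" (infix \<open>\<Turnstile>\<close> 50)

primrec labels_lfm :: "('x, 'c, 'p) lfm \<Rightarrow> label set" where
  "labels_lfm (Forces w A) = {w}"
| "labels_lfm (Rel w v) = {w, v}"
| "labels_lfm (Evid w t A) = {w}"

primrec labels :: "('x, 'c, 'p) sequent \<Rightarrow> label set" where
  "labels (\<Gamma> \<Turnstile> \<Delta>) = (\<Union>\<phi> \<in> set_mset (\<Gamma> + \<Delta>). labels_lfm \<phi>)"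

primrec lang_lfm :: "ax set \<Rightarrow> ('x, 'c, 'p) lfm \<Rightarrow> bool" where
  "lang_lfm L (Forces w A) \<longleftrightarrow> lang_fm L A"
| "lang_lfm L (Rel w v) \<longleftrightarrow> True"
| "lang_lfm L (Evid w t A) \<longleftrightarrow> lang_tm L t \<and> lang_fm L A"

primrec lang_sequent :: "ax set \<Rightarrow> ('x, 'c, 'p) sequent \<Rightarrow> bool" where
  "lang_sequent L (\<Gamma> \<Turnstile> \<Delta>) \<longleftrightarrow> (\<forall>\<phi> \<in># \<Gamma> + \<Delta>. lang_lfm L \<phi>)"

inductive initial :: "('x, 'c, 'p) sequent \<Rightarrow> bool" where
  "initial (add_mset (Forces w (PVar p)) \<Gamma> \<Turnstile> add_mset (Forces w (PVar p)) \<Delta>)"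
| "initial (add_mset (Forces w Bot) \<Gamma> \<Turnstile> \<Delta>)"
| "initial (add_mset (Rel w v) \<Gamma> \<Turnstile> add_mset (Rel w v) \<Delta>)"
| "initial (add_mset (Evid w t A) \<Gamma> \<Turnstile> add_mset (Evid w t A) \<Delta>)"

datatype rname =
    LNeg | RNeg | LAnd | RAnd | LOr | ROr | LImp | RImp | LJust | RJust
  | Ev | EvPlusL | EvPlusR | EvApp | AN
  | Ref | Ser | EvBang | Mon | Trans | EvQueryBar | Sym | StrongEv | EvQuery

text \<open>\<open>AN\<close> covers both (AN) and (IAN), which differ only in the constant specification.\<close>

definition G3JL_rules :: "ax set \<Rightarrow> rname set" where
  "G3JL_rules L =
     {LNeg, RNeg, LAnd, RAnd, LOr, ROr, LImp, RImp, LJust, RJust,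
      Ev, EvPlusL, EvPlusR, EvApp, AN} \<union>
     (if JT \<in> L then {Ref} else {}) \<union>
     (if JD \<in> L then {Ser} else {}) \<union>
     (if J4 \<in> L then {EvBang, Mon, Trans} else {}) \<union>
     (if JB \<in> L then {EvQueryBar, Sym} else {}) \<union>
     (if J5 \<in> L then {StrongEv, EvQuery} else {})"

text \<open>\<open>rule_scheme CS r ps S\<close>: rule \<open>r\<close> leads from the list of premises \<open>ps\<close> to the conclusion \<open>S\<close>.\<close>

inductive rule_scheme ::
  "('x, 'c, 'p) fm set \<Rightarrow> rname \<Rightarrow> ('x, 'c, 'p) sequent list \<Rightarrow> ('x, 'c, 'p) sequent \<Rightarrow> bool"
  for CS
where
  "rule_scheme CS LNeg
     [\<Gamma> \<Turnstile> add_mset (Forces w A) \<Delta>]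
     (add_mset (Forces w (Neg A)) \<Gamma> \<Turnstile> \<Delta>)"
| "rule_scheme CS RNeg
     [add_mset (Forces w A) \<Gamma> \<Turnstile> \<Delta>]
     (\<Gamma> \<Turnstile> add_mset (Forces w (Neg A)) \<Delta>)"
| "rule_scheme CS LAnd
     [{#Forces w A, Forces w B#} + \<Gamma> \<Turnstile> \<Delta>]
     (add_mset (Forces w (And A B)) \<Gamma> \<Turnstile> \<Delta>)"
| "rule_scheme CS RAnd
     [\<Gamma> \<Turnstile> add_mset (Forces w A) \<Delta>, \<Gamma> \<Turnstile> add_mset (Forces w B) \<Delta>]
     (\<Gamma> \<Turnstile> add_mset (Forces w (And A B)) \<Delta>)"
| "rule_scheme CS LOr
     [add_mset (Forces w A) \<Gamma> \<Turnstile> \<Delta>, add_mset (Forces w B) \<Gamma> \<Turnstile> \<Delta>]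
     (add_mset (Forces w (Or A B)) \<Gamma> \<Turnstile> \<Delta>)"
| "rule_scheme CS ROr
     [\<Gamma> \<Turnstile> {#Forces w A, Forces w B#} + \<Delta>]
     (\<Gamma> \<Turnstile> add_mset (Forces w (Or A B)) \<Delta>)"
| "rule_scheme CS LImp
     [\<Gamma> \<Turnstile> add_mset (Forces w A) \<Delta>, add_mset (Forces w B) \<Gamma> \<Turnstile> \<Delta>]
     (add_mset (Forces w (Imp A B)) \<Gamma> \<Turnstile> \<Delta>)"
| "rule_scheme CS RImp
     [add_mset (Forces w A) \<Gamma> \<Turnstile> add_mset (Forces w B) \<Delta>]
     (\<Gamma> \<Turnstile> add_mset (Forces w (Imp A B)) \<Delta>)"
| "rule_scheme CS LJust
     [{#Forces v A, Forces w (Just t A), Rel w v#} + \<Gamma> \<Turnstile> \<Delta>]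
     ({#Forces w (Just t A), Rel w v#} + \<Gamma> \<Turnstile> \<Delta>)"
| "v \<notin> labels (add_mset (Evid w t A) \<Gamma> \<Turnstile> add_mset (Forces w (Just t A)) \<Delta>) \<Longrightarrow>
   rule_scheme CS RJust
     [{#Rel w v, Evid w t A#} + \<Gamma> \<Turnstile> add_mset (Forces v A) \<Delta>]
     (add_mset (Evid w t A) \<Gamma> \<Turnstile> add_mset (Forces w (Just t A)) \<Delta>)"
| "rule_scheme CS Ev
     [{#Evid w t A, Forces w (Just t A)#} + \<Gamma> \<Turnstile> \<Delta>]
     (add_mset (Forces w (Just t A)) \<Gamma> \<Turnstile> \<Delta>)"
| "rule_scheme CS EvPlusL
     [{#Evid w (Plus s t) A, Evid w t A#} + \<Gamma> \<Turnstile> \<Delta>]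
     (add_mset (Evid w t A) \<Gamma> \<Turnstile> \<Delta>)"
| "rule_scheme CS EvPlusR
     [{#Evid w (Plus t s) A, Evid w t A#} + \<Gamma> \<Turnstile> \<Delta>]
     (add_mset (Evid w t A) \<Gamma> \<Turnstile> \<Delta>)"
| "rule_scheme CS EvApp
     [{#Evid w (App s t) B, Evid w s (Imp A B), Evid w t A#} + \<Gamma> \<Turnstile> \<Delta>]
     ({#Evid w s (Imp A B), Evid w t A#} + \<Gamma> \<Turnstile> \<Delta>)"
| "Just (JConst c) F \<in> CS \<Longrightarrow>
   rule_scheme CS AN
     [add_mset (Evid w (JConst c) F) \<Gamma> \<Turnstile> \<Delta>]
     (\<Gamma> \<Turnstile> \<Delta>)"
| "rule_scheme CS Ref
     [add_mset (Rel w w) \<Gamma> \<Turnstile> \<Delta>]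
     (\<Gamma> \<Turnstile> \<Delta>)"
| "v \<notin> labels (\<Gamma> \<Turnstile> \<Delta>) \<Longrightarrow>
   rule_scheme CS Ser
     [add_mset (Rel w v) \<Gamma> \<Turnstile> \<Delta>]
     (\<Gamma> \<Turnstile> \<Delta>)"
| "rule_scheme CS EvBang
     [{#Evid w (Bang t) (Just t A), Evid w t A#} + \<Gamma> \<Turnstile> \<Delta>]
     (add_mset (Evid w t A) \<Gamma> \<Turnstile> \<Delta>)"
| "rule_scheme CS Mon
     [{#Evid v t A, Evid w t A, Rel w v#} + \<Gamma> \<Turnstile> \<Delta>]
     ({#Evid w t A, Rel w v#} + \<Gamma> \<Turnstile> \<Delta>)"
| "rule_scheme CS Trans
     [{#Rel w u, Rel w v, Rel v u#} + \<Gamma> \<Turnstile> \<Delta>]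
     ({#Rel w v, Rel v u#} + \<Gamma> \<Turnstile> \<Delta>)"
| "rule_scheme CS EvQueryBar
     [add_mset (Forces w A) \<Gamma> \<Turnstile> \<Delta>,
      add_mset (Evid w (QueryBar t) (Neg (Just t A))) \<Gamma> \<Turnstile> \<Delta>]
     (\<Gamma> \<Turnstile> \<Delta>)"
| "rule_scheme CS Sym
     [{#Rel v w, Rel w v#} + \<Gamma> \<Turnstile> \<Delta>]
     (add_mset (Rel w v) \<Gamma> \<Turnstile> \<Delta>)"
| "rule_scheme CS StrongEv
     [{#Forces w (Just t A), Evid w t A#} + \<Gamma> \<Turnstile> \<Delta>]
     (add_mset (Evid w t A) \<Gamma> \<Turnstile> \<Delta>)"
| "rule_scheme CS EvQuery
     [add_mset (Evid w t A) \<Gamma> \<Turnstile> \<Delta>,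
      add_mset (Evid w (Query t) (Neg (Just t A))) \<Gamma> \<Turnstile> \<Delta>]
     (\<Gamma> \<Turnstile> \<Delta>)"

text \<open>
  Every schematic term and formula of a rule occurs in one of its sequents, so requiring all
  sequents to lie in the language restricts the schematic variables to that language.
\<close>

definition rule_instance ::
  "ax set \<Rightarrow> ('x, 'c, 'p) fm set \<Rightarrow> rname \<Rightarrow>
    ('x, 'c, 'p) sequent list \<Rightarrow> ('x, 'c, 'p) sequent \<Rightarrow> bool"
where
  "rule_instance L CS r ps S \<longleftrightarrow>
     rule_scheme CS r ps S \<and> lang_sequent L S \<and> (\<forall>P \<in> set ps. lang_sequent L P)"

text \<open>
  \<open>derivation L CS h S\<close>: there is a derivation of \<open>S\<close> whose height is exactly \<open>h\<close>.  Every rule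
  has at least one premise, so the maximum is taken over a nonempty set.
\<close>

inductive derivation ::
  "ax set \<Rightarrow> ('x, 'c, 'p) fm set \<Rightarrow> nat \<Rightarrow> ('x, 'c, 'p) sequent \<Rightarrow> bool"
  for L CS
where
  Initial: "initial S \<Longrightarrow> lang_sequent L S \<Longrightarrow> derivation L CS 0 S"
| Rule: "r \<in> G3JL_rules L \<Longrightarrow> rule_instance L CS r ps S \<Longrightarrow>
    list_all2 (derivation L CS) hs ps \<Longrightarrow> derivation L CS (Suc (Max (set hs))) S"

definition derivable_with_height ::
  "ax set \<Rightarrow> ('x, 'c, 'p) fm set \<Rightarrow> nat \<Rightarrow> ('x, 'c, 'p) sequent \<Rightarrow> bool"
where
  "derivable_with_height L CS n S \<longleftrightarrow> (\<exists>h \<le> n. derivation L CS h S)"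

definition hp_invertible :: "ax set \<Rightarrow> ('x, 'c, 'p) fm set \<Rightarrow> rname \<Rightarrow> bool" where
  "hp_invertible L CS r \<longleftrightarrow>
     (\<forall>ps S n. rule_instance L CS r ps S \<longrightarrow> derivable_with_height L CS n S \<longrightarrow>
        (\<forall>P \<in> set ps. derivable_with_height L CS n P))"

end

theory Submission
  imports Defs
begin

text \<open>
  In most rules every premise contains the conclusion, so inverting them is height-preserving
  weakening.  The exceptions are the propositional rules and the right rule for \<open>t : A\<close>; there
  the premise replaces a compound formula of the conclusion by smaller pieces (\<open>component\<close>
  below).  That replacement can be carried through a whole derivation, from the root upwards.  A
  compound formula is never principal in an initial sequent, so initial sequents stay initial.
  Where it lies in the context of the last rule, it is replaced in the premises, and the rule is
  applied again.  Where it is principal, its form determines the last rule, and a premise of that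
  rule is already the sequent sought, except that for \<open>t : A\<close> the eigenlabel chosen in the
  derivation has to be renamed to the desired label.

  Renaming and weakening are proved by a single induction (\<open>derivable_rename_weaken\<close>), since
  either one may force the eigenlabels inside the derivation to be changed.  To have one argument
  for all rules instead of one per rule, each rule is split into its active part and an arbitrary
  context (\<open>rule_schemeI\<close>, \<open>rule_schemeE\<close>): all that matters in the inductions is that active parts are
  closed under renaming (\<open>active_part_rename\<close>) and how they meet components
  (\<open>active_part_premise\<close>, \<open>active_part_component\<close>).
\<close>

section \<open>Composition and renaming of sequents\<close>

fun seq_union ::
  "('x, 'c, 'p) sequent \<Rightarrow> ('x, 'c, 'p) sequent \<Rightarrow> ('x, 'c, 'p) sequent" (infixl \<open>\<oplus>\<close> 65)
where
  "(\<Gamma> \<Turnstile> \<Delta>) \<oplus> (\<Gamma>' \<Turnstile> \<Delta>') = (\<Gamma> + \<Gamma>' \<Turnstile> \<Delta> + \<Delta>')"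

lemma seq_union_assoc: "S \<oplus> T \<oplus> U = S \<oplus> (T \<oplus> U)"
  by (cases S; cases T; cases U) (simp add: ac_simps)

lemma seq_union_commute: "S \<oplus> T = T \<oplus> S"
  by (cases S; cases T) (simp add: ac_simps)

lemma seq_union_left_commute: "S \<oplus> (T \<oplus> U) = T \<oplus> (S \<oplus> U)"
  by (cases S; cases T; cases U) (simp add: ac_simps)

lemmas seq_union_ac = seq_union_assoc seq_union_commute seq_union_left_commute

lemma labels_seq_union [simp]: "labels (S \<oplus> T) = labels S \<union> labels T"
  by (cases S; cases T) auto

lemma lang_seq_union [simp]: "lang_sequent L (S \<oplus> T) \<longleftrightarrow> lang_sequent L S \<and> lang_sequent L T"
  by (cases S; cases T) auto

lemma finite_labels:
  fixes S :: "('x, 'c, 'p) sequent"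
  shows "finite (labels S)"
proof -
  have "finite (labels_lfm \<phi>)" for \<phi> :: "('x, 'c, 'p) lfm"
    by (cases \<phi>) auto
  then show ?thesis
    by (cases S) auto
qed

primrec rename_lfm :: "(label \<Rightarrow> label) \<Rightarrow> ('x, 'c, 'p) lfm \<Rightarrow> ('x, 'c, 'p) lfm" where
  "rename_lfm f (Forces w A) = Forces (f w) A"
| "rename_lfm f (Rel w v) = Rel (f w) (f v)"
| "rename_lfm f (Evid w t A) = Evid (f w) t A"

primrec rename :: "(label \<Rightarrow> label) \<Rightarrow> ('x, 'c, 'p) sequent \<Rightarrow> ('x, 'c, 'p) sequent" where
  "rename f (\<Gamma> \<Turnstile> \<Delta>) = (image_mset (rename_lfm f) \<Gamma> \<Turnstile> image_mset (rename_lfm f) \<Delta>)"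

lemma rename_seq_union [simp]: "rename f (S \<oplus> T) = rename f S \<oplus> rename f T"
  by (cases S; cases T) auto

lemma lang_rename [simp]:
  fixes S :: "('x, 'c, 'p) sequent"
  shows "lang_sequent L (rename f S) = lang_sequent L S"
proof -
  have "lang_lfm L (rename_lfm f \<phi>) = lang_lfm L \<phi>" for \<phi> :: "('x, 'c, 'p) lfm"
    by (cases \<phi>) auto
  then show ?thesis
    by (cases S) auto
qed

lemma rename_cong:
  assumes "\<And>w. w \<in> labels S \<Longrightarrow> f w = g w"
  shows "rename f S = rename g S"
proof -
  have "rename_lfm f \<phi> = rename_lfm g \<phi>" if "labels_lfm \<phi> \<subseteq> labels S" for \<phi>
    using that assms by (cases \<phi>) auto
  then show ?thesis
    by (cases S) (force intro!: image_mset_cong)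
qed

lemma rename_ident:
  fixes S :: "('x, 'c, 'p) sequent"
  assumes "\<And>w. w \<in> labels S \<Longrightarrow> f w = w"
  shows "rename f S = S"
proof -
  have "rename_lfm id = (id :: ('x, 'c, 'p) lfm \<Rightarrow> _)"
  proof
    show "rename_lfm id \<phi> = id \<phi>" for \<phi> :: "('x, 'c, 'p) lfm"
      by (cases \<phi>) auto
  qed
  then have "rename id S = S"
    by (cases S) simp
  then show ?thesis
    using rename_cong[of S f id] assms by simp
qed

inductive single_formula :: "('x, 'c, 'p) sequent \<Rightarrow> bool" where
  "single_formula ({#\<phi>#} \<Turnstile> {#})"
| "single_formula ({#} \<Turnstile> {#\<phi>#})"

text \<open>
  Two decompositions of one sequent need a common refinement; a single formula cannot be divided
  between the two parts of the second one.
\<close>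

lemma single_union_cases:
  fixes P :: "('x, 'c, 'p) sequent"
  assumes "single_formula P" and "P \<oplus> C = Q \<oplus> D"
  obtains (left) R where "Q = P \<oplus> R" and "C = R \<oplus> D"
    | (right) R where "D = P \<oplus> R" and "C = Q \<oplus> R"
proof -
  have split: "(\<exists>R. M = add_mset \<phi> R \<and> K = R + N) \<or> (\<exists>R. N = add_mset \<phi> R \<and> K = M + R)"
    if eq: "add_mset \<phi> K = M + N" for \<phi> :: "('x, 'c, 'p) lfm" and K M N
  proof -
    from eq have "\<phi> \<in># M + N"
      by (metis union_single_eq_member)
    then consider R where "M = add_mset \<phi> R" | R where "N = add_mset \<phi> R"
      by (metis union_iff multi_member_split)
    then show ?thesis
      using eq by cases auto
  qed
  obtain \<Gamma> \<Delta> \<Gamma>1 \<Delta>1 \<Gamma>2 \<Delta>2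
    where C: "C = (\<Gamma> \<Turnstile> \<Delta>)" and Q: "Q = (\<Gamma>1 \<Turnstile> \<Delta>1)" and D: "D = (\<Gamma>2 \<Turnstile> \<Delta>2)"
    by (metis sequent.exhaust)
  from \<open>single_formula P\<close> show thesis
  proof cases
    case (1 \<phi>)
    with assms C Q D have eqs: "add_mset \<phi> \<Gamma> = \<Gamma>1 + \<Gamma>2" "\<Delta> = \<Delta>1 + \<Delta>2"
      by auto
    from split[OF eqs(1)] show thesis
    proof (elim disjE exE conjE)
      fix R assume "\<Gamma>1 = add_mset \<phi> R" "\<Gamma> = R + \<Gamma>2"
      with left[of "R \<Turnstile> \<Delta>1"] 1 C Q D eqs show thesis by simp
    next
      fix R assume "\<Gamma>2 = add_mset \<phi> R" "\<Gamma> = \<Gamma>1 + R"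
      with right[of "R \<Turnstile> \<Delta>2"] 1 C Q D eqs show thesis by simp
    qed
  next
    case (2 \<phi>)
    with assms C Q D have eqs: "add_mset \<phi> \<Delta> = \<Delta>1 + \<Delta>2" "\<Gamma> = \<Gamma>1 + \<Gamma>2"
      by auto
    from split[OF eqs(1)] show thesis
    proof (elim disjE exE conjE)
      fix R assume "\<Delta>1 = add_mset \<phi> R" "\<Delta> = R + \<Delta>2"
      with left[of "\<Gamma>1 \<Turnstile> R"] 2 C Q D eqs show thesis by simp
    next
      fix R assume "\<Delta>2 = add_mset \<phi> R" "\<Delta> = \<Delta>1 + R"
      with right[of "\<Gamma>2 \<Turnstile> R"] 2 C Q D eqs show thesis by simp
    qed
  qed
qed

section \<open>Rules as active parts in a context\<close>

text \<open>
  \<open>active_part CS r E Q as\<close>: with the context removed, rule \<open>r\<close> leads from the premises \<open>as\<close> to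
  \<open>Q\<close>, and \<open>E\<close> is the set of its eigenlabels.  The eigenlabel condition concerns the context too,
  hence it appears only in \<open>rule_schemeI\<close> and \<open>rule_schemeE\<close>; without it, active parts are closed under arbitrary
  renamings.
\<close>

inductive active_part ::
  "('x, 'c, 'p) fm set \<Rightarrow> rname \<Rightarrow> label set \<Rightarrow> ('x, 'c, 'p) sequent \<Rightarrow>
    ('x, 'c, 'p) sequent list \<Rightarrow> bool"
  for CS
where
  "active_part CS LNeg {} ({#Forces w (Neg A)#} \<Turnstile> {#}) [{#} \<Turnstile> {#Forces w A#}]"
| "active_part CS RNeg {} ({#} \<Turnstile> {#Forces w (Neg A)#}) [{#Forces w A#} \<Turnstile> {#}]"
| "active_part CS LAnd {} ({#Forces w (And A B)#} \<Turnstile> {#}) [{#Forces w A, Forces w B#} \<Turnstile> {#}]"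
| "active_part CS RAnd {} ({#} \<Turnstile> {#Forces w (And A B)#})
     [{#} \<Turnstile> {#Forces w A#}, {#} \<Turnstile> {#Forces w B#}]"
| "active_part CS LOr {} ({#Forces w (Or A B)#} \<Turnstile> {#})
     [{#Forces w A#} \<Turnstile> {#}, {#Forces w B#} \<Turnstile> {#}]"
| "active_part CS ROr {} ({#} \<Turnstile> {#Forces w (Or A B)#}) [{#} \<Turnstile> {#Forces w A, Forces w B#}]"
| "active_part CS LImp {} ({#Forces w (Imp A B)#} \<Turnstile> {#})
     [{#} \<Turnstile> {#Forces w A#}, {#Forces w B#} \<Turnstile> {#}]"
| "active_part CS RImp {} ({#} \<Turnstile> {#Forces w (Imp A B)#}) [{#Forces w A#} \<Turnstile> {#Forces w B#}]"
| "active_part CS LJust {} ({#Forces w (Just t A), Rel w v#} \<Turnstile> {#})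
     [{#Forces v A, Forces w (Just t A), Rel w v#} \<Turnstile> {#}]"
| "active_part CS RJust {v} ({#Evid w t A#} \<Turnstile> {#Forces w (Just t A)#})
     [{#Rel w v, Evid w t A#} \<Turnstile> {#Forces v A#}]"
| "active_part CS Ev {} ({#Forces w (Just t A)#} \<Turnstile> {#})
     [{#Evid w t A, Forces w (Just t A)#} \<Turnstile> {#}]"
| "active_part CS EvPlusL {} ({#Evid w t A#} \<Turnstile> {#}) [{#Evid w (Plus s t) A, Evid w t A#} \<Turnstile> {#}]"
| "active_part CS EvPlusR {} ({#Evid w t A#} \<Turnstile> {#}) [{#Evid w (Plus t s) A, Evid w t A#} \<Turnstile> {#}]"
| "active_part CS EvApp {} ({#Evid w s (Imp A B), Evid w t A#} \<Turnstile> {#})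
     [{#Evid w (App s t) B, Evid w s (Imp A B), Evid w t A#} \<Turnstile> {#}]"
| "Just (JConst c) F \<in> CS \<Longrightarrow>
   active_part CS AN {} ({#} \<Turnstile> {#}) [{#Evid w (JConst c) F#} \<Turnstile> {#}]"
| "active_part CS Ref {} ({#} \<Turnstile> {#}) [{#Rel w w#} \<Turnstile> {#}]"
| "active_part CS Ser {v} ({#} \<Turnstile> {#}) [{#Rel w v#} \<Turnstile> {#}]"
| "active_part CS EvBang {} ({#Evid w t A#} \<Turnstile> {#})
     [{#Evid w (Bang t) (Just t A), Evid w t A#} \<Turnstile> {#}]"
| "active_part CS Mon {} ({#Evid w t A, Rel w v#} \<Turnstile> {#})
     [{#Evid v t A, Evid w t A, Rel w v#} \<Turnstile> {#}]"
| "active_part CS Trans {} ({#Rel w v, Rel v u#} \<Turnstile> {#}) [{#Rel w u, Rel w v, Rel v u#} \<Turnstile> {#}]"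
| "active_part CS EvQueryBar {} ({#} \<Turnstile> {#})
     [{#Forces w A#} \<Turnstile> {#}, {#Evid w (QueryBar t) (Neg (Just t A))#} \<Turnstile> {#}]"
| "active_part CS Sym {} ({#Rel w v#} \<Turnstile> {#}) [{#Rel v w, Rel w v#} \<Turnstile> {#}]"
| "active_part CS StrongEv {} ({#Evid w t A#} \<Turnstile> {#}) [{#Forces w (Just t A), Evid w t A#} \<Turnstile> {#}]"
| "active_part CS EvQuery {} ({#} \<Turnstile> {#})
     [{#Evid w t A#} \<Turnstile> {#}, {#Evid w (Query t) (Neg (Just t A))#} \<Turnstile> {#}]"

lemma rule_schemeI:
  assumes "active_part CS r E Q as" and "E \<inter> labels (Q \<oplus> C) = {}"
  shows "rule_scheme CS r (map (\<lambda>a. a \<oplus> C) as) (Q \<oplus> C)"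
proof (cases C)
  case (Sequent \<Gamma> \<Delta>)
  from assms(1) assms(2)[unfolded Sequent] show ?thesis
    unfolding Sequent
    by (cases rule: active_part.cases)
      (simp_all add: rule_scheme.intros[where \<Gamma> = \<Gamma> and \<Delta> = \<Delta>, simplified])
qed

lemma rule_schemeE:
  assumes "rule_scheme CS r ps S"
  obtains E Q as C where "active_part CS r E Q as" and "S = Q \<oplus> C"
    and "ps = map (\<lambda>a. a \<oplus> C) as" and "E \<inter> labels S = {}"
proof -
  \<comment> \<open>Folding the existential statement into a predicate lets the 24 active parts, put into a
    context, serve as rewrite rules that match the rules of the calculus literally.\<close>
  define framed where "framed r ps S \<longleftrightarrow> (\<exists>E Q as C. active_part CS r E Q as \<and> S = Q \<oplus> C
    \<and> ps = map (\<lambda>a. a \<oplus> C) as \<and> E \<inter> labels S = {})" for r ps S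
  have framedI: "framed r (map (\<lambda>a. a \<oplus> (\<Gamma> \<Turnstile> \<Delta>)) as) (Q \<oplus> (\<Gamma> \<Turnstile> \<Delta>))"
    if "active_part CS r E Q as" "E \<inter> labels (Q \<oplus> (\<Gamma> \<Turnstile> \<Delta>)) = {}" for r E Q as \<Gamma> \<Delta>
    using that unfolding framed_def by blast
  from assms have "framed r ps S"
    by cases (simp_all add: active_part.intros[THEN framedI, simplified])
  with that show thesis
    unfolding framed_def by blast
qed

lemma active_part_rename:
  assumes "active_part CS r E Q as"
  shows "active_part CS r (f ` E) (rename f Q) (map (rename f) as)"
  using assms by cases (simp_all add: active_part.intros)

section \<open>Components of compound formulas\<close>

text \<open>
  For a justified formula on the right the label \<open>v\<close> of its component is arbitrary, and the
  evidence atom required by the right rule does not appear: it belongs to the context, which the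
  replacement leaves alone.
\<close>

inductive component :: "('x, 'c, 'p) sequent \<Rightarrow> ('x, 'c, 'p) sequent \<Rightarrow> bool" where
  "component ({#Forces w (Neg A)#} \<Turnstile> {#}) ({#} \<Turnstile> {#Forces w A#})"
| "component ({#} \<Turnstile> {#Forces w (Neg A)#}) ({#Forces w A#} \<Turnstile> {#})"
| "component ({#Forces w (And A B)#} \<Turnstile> {#}) ({#Forces w A, Forces w B#} \<Turnstile> {#})"
| "component ({#} \<Turnstile> {#Forces w (And A B)#}) ({#} \<Turnstile> {#Forces w A#})"
| "component ({#} \<Turnstile> {#Forces w (And A B)#}) ({#} \<Turnstile> {#Forces w B#})"
| "component ({#Forces w (Or A B)#} \<Turnstile> {#}) ({#Forces w A#} \<Turnstile> {#})"
| "component ({#Forces w (Or A B)#} \<Turnstile> {#}) ({#Forces w B#} \<Turnstile> {#})"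
| "component ({#} \<Turnstile> {#Forces w (Or A B)#}) ({#} \<Turnstile> {#Forces w A, Forces w B#})"
| "component ({#Forces w (Imp A B)#} \<Turnstile> {#}) ({#} \<Turnstile> {#Forces w A#})"
| "component ({#Forces w (Imp A B)#} \<Turnstile> {#}) ({#Forces w B#} \<Turnstile> {#})"
| "component ({#} \<Turnstile> {#Forces w (Imp A B)#}) ({#Forces w A#} \<Turnstile> {#Forces w B#})"
| "component ({#} \<Turnstile> {#Forces w (Just t A)#}) ({#Rel w v#} \<Turnstile> {#Forces v A#})"

lemma component_single: "component P X \<Longrightarrow> single_formula P"
  by (cases rule: component.cases) (auto intro: single_formula.intros)

lemma component_lang: "component P X \<Longrightarrow> lang_sequent L P \<Longrightarrow> lang_sequent L X"
  by (cases rule: component.cases) auto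

lemma seq_union_exists_iff:
  "(\<exists>X. (\<Gamma> \<Turnstile> \<Delta>) = (\<Gamma>' \<Turnstile> \<Delta>') \<oplus> X) \<longleftrightarrow> \<Gamma>' \<subseteq># \<Gamma> \<and> \<Delta>' \<subseteq># \<Delta>"
proof
  assume "\<exists>X. (\<Gamma> \<Turnstile> \<Delta>) = (\<Gamma>' \<Turnstile> \<Delta>') \<oplus> X"
  then obtain X where "(\<Gamma> \<Turnstile> \<Delta>) = (\<Gamma>' \<Turnstile> \<Delta>') \<oplus> X" ..
  then show "\<Gamma>' \<subseteq># \<Gamma> \<and> \<Delta>' \<subseteq># \<Delta>"
    by (cases X) auto
next
  assume "\<Gamma>' \<subseteq># \<Gamma> \<and> \<Delta>' \<subseteq># \<Delta>"
  then have "(\<Gamma> \<Turnstile> \<Delta>) = (\<Gamma>' \<Turnstile> \<Delta>') \<oplus> (\<Gamma> - \<Gamma>' \<Turnstile> \<Delta> - \<Delta>')"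
    by simp
  then show "\<exists>X. (\<Gamma> \<Turnstile> \<Delta>) = (\<Gamma>' \<Turnstile> \<Delta>') \<oplus> X" ..
qed

text \<open>
  This sorts the inversions to be proved: a premise either contains the conclusion, or arises from
  it by replacing one compound formula \<open>P\<close>.  The remainder \<open>R\<close> is empty except in the right rule
  for \<open>t : A\<close>, where it holds the evidence atom.
\<close>

lemma active_part_premise:
  assumes "active_part CS r E Q as" and "a \<in> set as"
  obtains (cumulative) X where "a = Q \<oplus> X"
    | (replacing) P X R where "component P X" and "Q = P \<oplus> R" and "a = X \<oplus> R"
proof (cases "r = RJust")
  case True
  with assms obtain w v t A where "Q = ({#Evid w t A#} \<Turnstile> {#Forces w (Just t A)#})"
    "a = ({#Rel w v, Evid w t A#} \<Turnstile> {#Forces v A#})"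
    by (auto elim!: active_part.cases)
  then show thesis
    using replacing[OF component.intros(12)[of w t A v], of "{#Evid w t A#} \<Turnstile> {#}"] by simp
next
  case False
  with assms have "component Q a \<or> (\<exists>X. a = Q \<oplus> X)"
    by (cases rule: active_part.cases) (auto simp: component.intros seq_union_exists_iff)
  then show thesis
    using cumulative replacing[of Q a "{#} \<Turnstile> {#}"] by (cases Q; cases a) auto
qed

text \<open>
  If \<open>P\<close> has components, then the only rule with \<open>P\<close> in the active part of its conclusion is the
  one that introduces \<open>P\<close>: the rules that repeat their active formulas in the premises act on
  relational atoms, evidence atoms and justified formulas on the left, and these have no
  components.  The map \<open>f\<close> is needed for the right rule for \<open>t : A\<close> alone.
\<close>

lemma active_part_component:
  assumes "active_part CS r E (P \<oplus> R) as" and "component P X" and "E \<inter> labels (P \<oplus> R) = {}"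
  obtains f a where "a \<in> set as" and "\<And>w. w \<notin> E \<Longrightarrow> f w = w" and "rename f a = X \<oplus> R"
proof -
  obtain \<Gamma>P \<Delta>P \<Gamma>R \<Delta>R where P: "P = (\<Gamma>P \<Turnstile> \<Delta>P)" and R: "R = (\<Gamma>R \<Turnstile> \<Delta>R)"
    by (metis sequent.exhaust)
  define \<Gamma> \<Delta> where "\<Gamma> = \<Gamma>P + \<Gamma>R" and "\<Delta> = \<Delta>P + \<Delta>R"
  then have PR: "P \<oplus> R = (\<Gamma> \<Turnstile> \<Delta>)" and R': "R = (\<Gamma> - \<Gamma>P \<Turnstile> \<Delta> - \<Delta>P)"
    and sub: "\<Gamma>P \<subseteq># \<Gamma>" "\<Delta>P \<subseteq># \<Delta>"
    by (simp_all add: P R)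
  note part = assms(1,3)[unfolded PR]
  have "\<exists>f. \<exists>a \<in> set as. (\<forall>w. w \<notin> E \<longrightarrow> f w = w) \<and> rename f a = X \<oplus> R"
  proof (cases "r = RJust")
    case True
    with part obtain u w t A
      where *: "\<Gamma> = {#Evid w t A#}" "\<Delta> = {#Forces w (Just t A)#}" "E = {u}" "u \<noteq> w"
        "as = [{#Rel w u, Evid w t A#} \<Turnstile> {#Forces u A#}]"
      by (auto elim: active_part.cases)
    with assms(2) sub obtain v
      where "\<Gamma>P = {#}" "\<Delta>P = {#Forces w (Just t A)#}" "X = ({#Rel w v#} \<Turnstile> {#Forces v A#})"
      unfolding P by (auto elim: component.cases)
    \<comment> \<open>The eigenlabel \<open>u\<close> of the rule instance is traded for the label \<open>v\<close> that is asked for;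
      as \<open>u\<close> differs from \<open>w\<close>, this leaves the evidence atom and the first label of \<open>wRu\<close> alone.\<close>
    with * show ?thesis
      unfolding R' by (intro exI[of _ "id(u := v)"]) auto
  next
    case False
    from assms(2)[unfolded P] have "\<exists>a \<in> set as. a = X \<oplus> R"
      unfolding R' by cases (use part(1) False sub in \<open>cases rule: active_part.cases; simp\<close>)+
    then show ?thesis
      using rename_ident[of _ id] by (intro exI[of _ id]) auto
  qed
  with that show thesis by blast
qed

section \<open>Derivability with bounded height\<close>

lemma derivable_lang: "derivable_with_height L CS n S \<Longrightarrow> lang_sequent L S"
  by (auto simp: derivable_with_height_def rule_instance_def elim: derivation.cases)

lemma derivable_mono:
  "derivable_with_height L CS m S \<Longrightarrow> m \<le> n \<Longrightarrow> derivable_with_height L CS n S"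
  by (auto simp: derivable_with_height_def intro: le_trans)

lemma derivable_initial:
  "initial S \<Longrightarrow> lang_sequent L S \<Longrightarrow> derivable_with_height L CS n S"
  by (auto simp: derivable_with_height_def intro: derivation.Initial)

lemma derivable_ruleI:
  assumes "r \<in> G3JL_rules L" and "active_part CS r E Q as" and "E \<inter> labels (Q \<oplus> C) = {}"
    and "lang_sequent L (Q \<oplus> C)"
    and prems: "\<And>a. a \<in> set as \<Longrightarrow> derivable_with_height L CS n (a \<oplus> C)"
  shows "derivable_with_height L CS (Suc n) (Q \<oplus> C)"
proof -
  let ?ps = "map (\<lambda>a. a \<oplus> C) as"
  from prems obtain h where h: "h a \<le> n" "derivation L CS (h a) (a \<oplus> C)" if "a \<in> set as" for a
    unfolding derivable_with_height_def by metis
  have "rule_instance L CS r ?ps (Q \<oplus> C)"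
    using rule_schemeI[OF assms(2,3)] assms(4) derivable_lang[OF prems]
    by (auto simp: rule_instance_def)
  moreover have "list_all2 (derivation L CS) (map h as) ?ps"
    using h(2) by (simp add: list_all2_conv_all_nth)
  ultimately have "derivation L CS (Suc (Max (set (map h as)))) (Q \<oplus> C)"
    using assms(1) by (intro derivation.Rule)
  moreover have "as \<noteq> []"
    using assms(2) by cases auto
  then have "Max (set (map h as)) \<le> n"
    using h(1) by simp
  ultimately show ?thesis
    unfolding derivable_with_height_def by (meson Suc_le_mono)
qed

lemma derivable_cases:
  assumes "derivable_with_height L CS n S"
  obtains (initial) "initial S"
    | (rule) m r E Q as C where "n = Suc m" and "r \<in> G3JL_rules L" and "active_part CS r E Q as"
        and "S = Q \<oplus> C" and "E \<inter> labels S = {}"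
        and "\<And>a. a \<in> set as \<Longrightarrow> derivable_with_height L CS m (a \<oplus> C)"
proof -
  from assms obtain k where k: "k \<le> n" "derivation L CS k S"
    by (auto simp: derivable_with_height_def)
  from k(2) show thesis
  proof cases
    case Initial
    then show thesis by (intro initial)
  next
    case (Rule r ps hs)
    then obtain E Q as C where part: "active_part CS r E Q as" "S = Q \<oplus> C"
      "ps = map (\<lambda>a. a \<oplus> C) as" "E \<inter> labels S = {}"
      unfolding rule_instance_def by (elim conjE rule_schemeE)
    from Rule k obtain m where m: "n = Suc m" "Max (set hs) \<le> m"
      by (cases n) auto
    have "derivable_with_height L CS m (a \<oplus> C)" if "a \<in> set as" for a
    proof -
      from that part have "a \<oplus> C \<in> set ps" by simp
      with Rule obtain h where "h \<in> set hs" "derivation L CS h (a \<oplus> C)"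
        by (metis in_set_conv_nth list_all2_conv_all_nth)
      moreover from this m have "h \<le> m"
        by (meson List.finite_set Max_ge le_trans)
      ultimately show ?thesis
        by (auto simp: derivable_with_height_def)
    qed
    with m part Rule show thesis
      by (intro rule)
  qed
qed

lemma initial_iff:
  "initial (\<Gamma> \<Turnstile> \<Delta>) \<longleftrightarrow>
     (\<exists>w p. Forces w (PVar p) \<in># \<Gamma> \<and> Forces w (PVar p) \<in># \<Delta>) \<or> (\<exists>w. Forces w Bot \<in># \<Gamma>) \<or>
     (\<exists>w v. Rel w v \<in># \<Gamma> \<and> Rel w v \<in># \<Delta>) \<or> (\<exists>w t A. Evid w t A \<in># \<Gamma> \<and> Evid w t A \<in># \<Delta>)"
  (is "?L \<longleftrightarrow> ?R")
proof
  show "?L \<Longrightarrow> ?R"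
    by (cases rule: initial.cases) (assumption | force)+
  show "?R \<Longrightarrow> ?L"
    by (elim disjE exE conjE) (auto dest!: multi_member_split intro: initial.intros)
qed

lemma initial_rename_weaken:
  assumes "initial S"
  shows "initial (rename f S \<oplus> W)"
  using assms by (cases W; cases rule: initial.cases) (simp_all add: initial.intros)

lemma initial_component:
  assumes "initial (P \<oplus> C)" and "component P X"
  shows "initial (X \<oplus> C)"
  using assms(2,1) by (cases C; cases rule: component.cases) (auto simp: initial_iff)

section \<open>Renaming, weakening and inversion\<close>

text \<open>
  The label map may identify labels, so \<open>f\<close> alone could send an eigenlabel to a label of the
  conclusion.  Eigenlabels do not occur in the conclusion, so redefining \<open>f\<close> on them does not
  affect it, and they can be sent to a label that is fresh for the result.
\<close>

lemma derivable_rename_weaken: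
  assumes "derivable_with_height L CS n S" and "lang_sequent L W"
  shows "derivable_with_height L CS n (rename f S \<oplus> W)"
  using assms
proof (induction n arbitrary: S f W rule: less_induct)
  case (less n S f W)
  from less.prems(1) show ?case
  proof (cases rule: derivable_cases)
    case initial
    then show ?thesis
      using less.prems by (simp add: derivable_initial derivable_lang initial_rename_weaken)
  next
    case (rule m r E Q as C)
    obtain u where u: "u \<notin> labels (rename f S \<oplus> W)"
      using ex_new_if_finite[OF infinite_UNIV_nat finite_labels] by blast
    define g where "g w = (if w \<in> E then u else f w)" for w
    have S: "rename f S = rename g S"
      using rule(5) by (intro rename_cong) (auto simp: g_def)
    have "derivable_with_height L CS (Suc m) (rename g Q \<oplus> (rename g C \<oplus> W))"
    proof (rule derivable_ruleI[OF rule(2) active_part_rename[OF rule(3), of g]])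
      have "g ` E \<subseteq> {u}"
        by (auto simp: g_def)
      then show "g ` E \<inter> labels (rename g Q \<oplus> (rename g C \<oplus> W)) = {}"
        using u[unfolded S] rule(4) by auto
      show "lang_sequent L (rename g Q \<oplus> (rename g C \<oplus> W))"
        using derivable_lang[OF less.prems(1)] less.prems(2) rule(4) by simp
      fix a assume "a \<in> set (map (rename g) as)"
      then obtain b where "b \<in> set as" "a = rename g b"
        by auto
      then show "derivable_with_height L CS m (a \<oplus> (rename g C \<oplus> W))"
        using less.IH[of m "b \<oplus> C" W g] rule(1,6) less.prems(2) by (simp add: seq_union_assoc)
    qed
    moreover have "rename f S \<oplus> W = rename g Q \<oplus> (rename g C \<oplus> W)"
      unfolding S by (simp add: rule(4) seq_union_assoc)
    ultimately show ?thesis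
      using rule(1) by simp
  qed
qed

lemma derivable_rename:
  assumes "derivable_with_height L CS n S"
  shows "derivable_with_height L CS n (rename f S)"
  using derivable_rename_weaken[OF assms, of "{#} \<Turnstile> {#}" f]
  by (cases "rename f S") simp

lemma derivable_weaken:
  assumes "derivable_with_height L CS n S" and "lang_sequent L W"
  shows "derivable_with_height L CS n (S \<oplus> W)"
  using derivable_rename_weaken[OF assms, of id] by (simp add: rename_ident)

text \<open>The last rule of a derivation may be assumed to use eigenlabels outside any finite set.\<close>

lemma derivable_fresh_cases:
  assumes "derivable_with_height L CS n S" and "finite F"
  obtains (initial) "initial S"
    | (rule) m r E Q as C where "n = Suc m" and "r \<in> G3JL_rules L" and "active_part CS r E Q as"
        and "S = Q \<oplus> C" and "E \<inter> (labels S \<union> F) = {}"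
        and "\<And>a. a \<in> set as \<Longrightarrow> derivable_with_height L CS m (a \<oplus> C)"
  using assms(1)
proof (cases rule: derivable_cases)
  case initial
  then show thesis by (rule that(1))
next
  case (rule m r E Q as C)
  have "finite (labels S \<union> F)"
    using assms(2) finite_labels by blast
  then obtain u where u: "u \<notin> labels S \<union> F"
    using ex_new_if_finite[OF infinite_UNIV_nat] by blast
  define g where "g w = (if w \<in> E then u else w)" for w
  have "rename g Q = Q" and C: "rename g C = C"
    using rule(4,5) by (auto intro!: rename_ident simp: g_def)
  with active_part_rename[OF rule(3), of g]
  have "active_part CS r (g ` E) Q (map (rename g) as)"
    by simp
  moreover have "g ` E \<inter> (labels S \<union> F) = {}"
    using u by (auto simp: g_def)
  moreover have "derivable_with_height L CS m (a \<oplus> C)" if "a \<in> set (map (rename g) as)" for a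
    using that derivable_rename[OF rule(6), of _ g] C by auto
  ultimately show thesis
    using rule(1,2,4) by (intro that(2))
qed

text \<open>
  This is the heart of the matter: a compound formula may be replaced by its components without
  raising the height.  Eigenlabels are chosen outside the labels of \<open>X\<close>, so that the last rule
  still applies after the replacement in its context.
\<close>

lemma derivable_component:
  assumes "derivable_with_height L CS n (P \<oplus> C)" and "component P X"
  shows "derivable_with_height L CS n (X \<oplus> C)"
  using assms(1)
proof (induction n arbitrary: C rule: less_induct)
  case (less n C)
  have lang: "lang_sequent L X" "lang_sequent L C"
    using derivable_lang[OF less.prems] component_lang[OF assms(2)] by auto
  show ?case
    using less.prems finite_labels[of X]
  proof (cases rule: derivable_fresh_cases)
    case initial
    then show ?thesis
      using initial_component[OF _ assms(2)] lang by (simp add: derivable_initial)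
  next
    case (rule m r E Q as D)
    from component_single[OF assms(2)] rule(4) show ?thesis
    proof (cases rule: single_union_cases)
      case (left R)
      have "E \<inter> labels (P \<oplus> R) = {}"
        using rule(5) left by auto
      then obtain f a
        where a: "a \<in> set as" "\<And>w. w \<notin> E \<Longrightarrow> f w = w" "rename f a = X \<oplus> R"
        using active_part_component[OF rule(3)[unfolded left(1)] assms(2)] by blast
      have "rename f D = D"
        using a(2) rule(5) left by (intro rename_ident) auto
      then have "derivable_with_height L CS m (X \<oplus> C)"
        using derivable_rename[OF rule(6)[OF a(1)], of f] a(3) left(2)
        by (simp add: seq_union_assoc)
      then show ?thesis
        using rule(1) by (auto intro: derivable_mono)
    next
      case (right R)
      have "derivable_with_height L CS (Suc m) (Q \<oplus> (X \<oplus> R))"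
      proof (rule derivable_ruleI[OF rule(2,3)])
        show "E \<inter> labels (Q \<oplus> (X \<oplus> R)) = {}" "lang_sequent L (Q \<oplus> (X \<oplus> R))"
          using rule(5) right lang by auto
        fix a assume "a \<in> set as"
        then have "derivable_with_height L CS m (P \<oplus> (a \<oplus> R))"
          using rule(6) right(1) by (metis seq_union_left_commute)
        then have "derivable_with_height L CS m (X \<oplus> (a \<oplus> R))"
          using less.IH rule(1) by simp
        then show "derivable_with_height L CS m (a \<oplus> (X \<oplus> R))"
          by (metis seq_union_left_commute)
      qed
      then show ?thesis
        using rule(1) right(2) by (metis seq_union_left_commute)
    qed
  qed
qed

theorem proposition7p1:
  fixes L :: "ax set" and CS :: "('x, 'c, 'p) fm set"
  assumes "justification_logic L" and "constant_specification L CS"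
  shows "\<forall>r \<in> G3JL_rules L. hp_invertible L CS r"
  unfolding hp_invertible_def
proof (intro ballI allI impI)
  fix r ps and S P :: "('x, 'c, 'p) sequent" and n
  assume inst: "rule_instance L CS r ps S" and S: "derivable_with_height L CS n S"
    and P: "P \<in> set ps"
  from inst obtain E Q as C where part: "active_part CS r E Q as" "S = Q \<oplus> C"
    "ps = map (\<lambda>a. a \<oplus> C) as"
    unfolding rule_instance_def by (elim conjE rule_schemeE)
  with P obtain a where a: "a \<in> set as" "P = a \<oplus> C"
    by auto
  from part(1) a(1) show "derivable_with_height L CS n P"
  proof (cases rule: active_part_premise)
    case (cumulative X)
    have "lang_sequent L X"
      using inst P a(2) cumulative by (auto simp: rule_instance_def)
    then have "derivable_with_height L CS n (S \<oplus> X)"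
      using derivable_weaken[OF S] by blast
    then show ?thesis
      using a(2) part(2) cumulative by (simp add: seq_union_ac)
  next
    case (replacing P' X R)
    then show ?thesis
      using derivable_component[of L CS n P' "R \<oplus> C" X] S a(2) part(2)
      by (simp add: seq_union_assoc)
  qed
qed

end
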